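(* There exists a residuated lattice $A$ that does not satisfy the identity $\neg a\vee\neg\neg a=1$ for all $a\in A$, but whose reticulation $\mathcal{L}(A)$ is a pseudocomplemented lattice satisfying $l^{*}\vee l^{**}=1$ for all $l\in\mathcal{L}(A)$.
   Context: A residuated lattice is an algebra $(A,\vee,\wedge,\odot,\rightarrow,0,1)$ such that $(A,\vee,\wedge,0,1)$ is a bounded lattice, $(A,\odot,1)$ is a commutative monoid, and $a\leq b\rightarrow c$ iff $a\odot b\leq c$ for all $a,b,c\in A$. $\neg a=a\rightarrow 0$, and $a^n$ is the $n$-fold $\odot$-product of $a$. A reticulation of $A$ is a pair $(\mathcal{L}(A),\lambda)$ with $\mathcal{L}(A)$ a bounded distributive lattice and $\lambda:A\to\mathcal{L}(A)$ a surjective function such that for all $a,b\in A$: $\lambda(a\odot b)=\lambda(a)\wedge\lambda(b)$; $\lambda(a\vee b)=\lambda(a)\vee\lambda(b)$; $\lambda(0)=0$, $\lambda(1)=1$; and $\lambda(a)\leq\lambda(b)$ iff $a^n\leq b$ for some integer $n\geq 1$. A reticulation exists and is unique up to isomorphism (compatible with $\lambda$). In a distributive lattice with $0$, the pseudocomplement $l^{*}$ of $l$ is the greatest element $k$ with $l\wedge k=0$, if it exists; the lattice is pseudocomplemented iff every element has a pseudocomplement. $l^{**}=(l^* )^*$. *)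

theory Defs
  imports "HOL-Algebra.Group"
begin

record 'a residuated = "'a gorder" +
  odot :: "'a \<Rightarrow> 'a \<Rightarrow> 'a" (infixl \<open>\<odot>\<index>\<close> 72)
  res  :: "'a \<Rightarrow> 'a \<Rightarrow> 'a" (infixr \<open>\<rightharpoonup>\<index>\<close> 67)

text \<open>The constant 1 is the top of the lattice and the unit of the product at the same time, so it
  is not a separate field of the record.\<close>

definition odot_monoid :: "('a, 'm) residuated_scheme \<Rightarrow> 'a monoid" where
  "odot_monoid A = \<lparr>carrier = carrier A, monoid.mult = odot A, one = \<top>\<^bsub>A\<^esub>\<rparr>"

locale residuated_lattice = bounded_lattice A for A (structure) +
  assumes odot_comm_monoid: "comm_monoid (odot_monoid A)"
    and res_closed: "\<lbrakk>a \<in> carrier A; b \<in> carrier A\<rbrakk> \<Longrightarrow> a \<rightharpoonup> b \<in> carrier A"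
    and residuation: "\<lbrakk>a \<in> carrier A; b \<in> carrier A; c \<in> carrier A\<rbrakk>
      \<Longrightarrow> a \<sqsubseteq> b \<rightharpoonup> c \<longleftrightarrow> a \<odot> b \<sqsubseteq> c"

definition neg :: "('a, 'm) residuated_scheme \<Rightarrow> 'a \<Rightarrow> 'a" where
  "neg A a = a \<rightharpoonup>\<^bsub>A\<^esub> \<bottom>\<^bsub>A\<^esub>"

definition odot_pow :: "('a, 'm) residuated_scheme \<Rightarrow> 'a \<Rightarrow> nat \<Rightarrow> 'a" where
  "odot_pow A a n = a [^]\<^bsub>odot_monoid A\<^esub> n"

locale bounded_distributive_lattice = bounded_lattice L for L (structure) +
  assumes meet_join_distrib: "\<lbrakk>x \<in> carrier L; y \<in> carrier L; z \<in> carrier L\<rbrakk>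
    \<Longrightarrow> x \<sqinter> (y \<squnion> z) = (x \<sqinter> y) \<squnion> (x \<sqinter> z)"

locale reticulation = A: residuated_lattice A + L: bounded_distributive_lattice L
  for A :: "('a, 'm) residuated_scheme" and L :: "('b, 'n) gorder_scheme"
    and lam :: "'a \<Rightarrow> 'b" +
  assumes lam_surj: "lam ` carrier A = carrier L"
    and lam_odot: "\<lbrakk>a \<in> carrier A; b \<in> carrier A\<rbrakk>
      \<Longrightarrow> lam (a \<odot>\<^bsub>A\<^esub> b) = lam a \<sqinter>\<^bsub>L\<^esub> lam b"
    and lam_join: "\<lbrakk>a \<in> carrier A; b \<in> carrier A\<rbrakk>
      \<Longrightarrow> lam (a \<squnion>\<^bsub>A\<^esub> b) = lam a \<squnion>\<^bsub>L\<^esub> lam b"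
    and lam_bottom: "lam \<bottom>\<^bsub>A\<^esub> = \<bottom>\<^bsub>L\<^esub>"
    and lam_top: "lam \<top>\<^bsub>A\<^esub> = \<top>\<^bsub>L\<^esub>"
    and lam_le_iff: "\<lbrakk>a \<in> carrier A; b \<in> carrier A\<rbrakk>
      \<Longrightarrow> lam a \<sqsubseteq>\<^bsub>L\<^esub> lam b \<longleftrightarrow> (\<exists>n\<ge>1. odot_pow A a n \<sqsubseteq>\<^bsub>A\<^esub> b)"

definition is_pseudocomplement :: "('b, 'n) gorder_scheme \<Rightarrow> 'b \<Rightarrow> 'b \<Rightarrow> bool" where
  "is_pseudocomplement L l k \<longleftrightarrow> greatest L k {x \<in> carrier L. l \<sqinter>\<^bsub>L\<^esub> x = \<bottom>\<^bsub>L\<^esub>}"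

definition pseudocomplemented :: "('b, 'n) gorder_scheme \<Rightarrow> bool" where
  "pseudocomplemented L \<longleftrightarrow> (\<forall>l\<in>carrier L. \<exists>k. is_pseudocomplement L l k)"

text \<open>Only meaningful where the pseudocomplement exists.\<close>

definition pcompl :: "('b, 'n) gorder_scheme \<Rightarrow> 'b \<Rightarrow> 'b" where
  "pcompl L l = (THE k. is_pseudocomplement L l k)"

end

(*
  The identity fails in every finite Lukasiewicz chain with a third element a strictly between the
  bounds, since the negation of that chain is an involution that reverses the order. Every element
  other than the top is nilpotent there, so the reticulation identifies all of them with 0 and is
  the two-element chain. In a bounded chain the pseudocomplement of 0 is 1 and that of every other
  element is 0, so the Stone identity holds.
*)
theory Submission
  imports Defs
begin

text \<open>The algebra and its reticulation both live on an initial segment of the naturals. The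
  record scheme \<open>'m\<close> lets one set of lattice facts serve both, with or without
  \<open>odot\<close> and \<open>res\<close>.\<close>

locale nat_chain =
  fixes L :: "(nat, 'm) gorder_scheme" (structure) and n :: nat
  assumes carrier_eq [simp]: "carrier L = {..n}"
    and eq_eq [simp]: "eq L = (=)"
    and le_eq [simp]: "le L = (\<le>)"
begin

lemma total_order: "total_order L"
  by unfold_locales auto

lemma bounded_lattice: "bounded_lattice L"
proof -
  interpret total_order L by (rule total_order)
  show ?thesis
    by unfold_locales (auto simp: least_def greatest_def)
qed

end

sublocale nat_chain \<subseteq> bounded_lattice L
  by (rule bounded_lattice)

context nat_chain
begin

lemma bottom_eq_0 [simp]: "\<bottom> = 0"
  using bottom_lower[of 0] by simp

lemma top_eq_n [simp]: "\<top> = n"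
  using top_closed top_higher[of n] by simp

lemma join_eq_max [simp]: "x \<le> n \<Longrightarrow> y \<le> n \<Longrightarrow> x \<squnion> y = max x y"
proof (rule antisym)
  assume "x \<le> n" "y \<le> n"
  then show "max x y \<le> x \<squnion> y"
    using join_left[of x y] join_right[of x y] by simp
  show "x \<squnion> y \<le> max x y"
    using join_le[of x "max x y" y] \<open>x \<le> n\<close> \<open>y \<le> n\<close> by simp
qed

lemma meet_eq_min [simp]: "x \<le> n \<Longrightarrow> y \<le> n \<Longrightarrow> x \<sqinter> y = min x y"
proof (rule antisym)
  assume "x \<le> n" "y \<le> n"
  then show "x \<sqinter> y \<le> min x y"
    using meet_left[of x y] meet_right[of x y] by simp
  show "min x y \<le> x \<sqinter> y"
    using meet_le[of "min x y" x y] \<open>x \<le> n\<close> \<open>y \<le> n\<close> by simp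
qed

lemma bounded_distributive_lattice: "bounded_distributive_lattice L"
  by unfold_locales (simp add: min_max_distrib2 min.coboundedI1)

lemma is_pseudocomplement_iff:
  assumes "l \<le> n"
  shows "is_pseudocomplement L l k \<longleftrightarrow> k = (if l = 0 then n else 0)"
proof -
  have "{x \<in> carrier L. l \<sqinter> x = \<bottom>} = (if l = 0 then {..n} else {0})"
    using assms by (auto simp: min_def split: if_splits)
  then show ?thesis
    by (auto simp: is_pseudocomplement_def greatest_def intro: antisym)
qed

lemma pseudocomplemented: "pseudocomplemented L"
  by (simp add: pseudocomplemented_def is_pseudocomplement_iff)

lemma pcompl_eq: "l \<le> n \<Longrightarrow> pcompl L l = (if l = 0 then n else 0)"
  by (simp add: pcompl_def is_pseudocomplement_iff)

text \<open>One of the two pseudocomplements is always \<open>n\<close>, and the join is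
  \<open>max\<close>.\<close>

lemma stone_identity:
  assumes "l \<in> carrier L"
  shows "pcompl L l \<squnion> pcompl L (pcompl L l) = \<top>"
  using assms by (simp add: pcompl_eq)

end

definition chain :: "nat \<Rightarrow> nat gorder" where
  "chain n = \<lparr>carrier = {..n}, eq = (=), le = (\<le>)\<rparr>"

interpretation chain: nat_chain "chain n" n for n
  by unfold_locales (simp_all add: chain_def)

text \<open>The element \<open>a\<close> stands for the fraction \<open>a / n\<close> of the real unit interval. Truncated
  subtraction supplies the maximum with 0 in the Lukasiewicz product.\<close>

definition lukasiewicz :: "nat \<Rightarrow> nat residuated" where
  "lukasiewicz n = \<lparr>carrier = {..n}, eq = (=), le = (\<le>),
     odot = (\<lambda>a b. a + b - n), res = (\<lambda>a b. min n (n - a + b))\<rparr>"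

interpretation lukasiewicz: nat_chain "lukasiewicz n" n for n
  by unfold_locales (simp_all add: lukasiewicz_def)

lemma odot_lukasiewicz [simp]: "a \<odot>\<^bsub>lukasiewicz n\<^esub> b = a + b - n"
  by (simp add: lukasiewicz_def)

lemma res_lukasiewicz [simp]: "a \<rightharpoonup>\<^bsub>lukasiewicz n\<^esub> b = min n (n - a + b)"
  by (simp add: lukasiewicz_def)

lemma residuated_lattice_lukasiewicz: "residuated_lattice (lukasiewicz n)"
proof (intro residuated_lattice.intro residuated_lattice_axioms.intro)
  show "bounded_lattice (lukasiewicz n)"
    by (rule lukasiewicz.bounded_lattice)
  show "comm_monoid (odot_monoid (lukasiewicz n))"
    \<comment> \<open>Associativity: on elements \<le> \<open>n\<close>, both bracketings equal
      \<open>a + b + c - 2 * n\<close>, because a product truncated to 0 stays 0 after another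
      factor.\<close>
    by (rule comm_monoidI) (auto simp: odot_monoid_def)
\<comment> \<open>Residuation: as \<open>a \<le> n\<close> anyway, both sides say
  \<open>a + b \<le> n + c\<close>.\<close>
qed auto

lemma neg_lukasiewicz: "neg (lukasiewicz n) a = n - a"
  by (simp add: neg_def)

text \<open>Each factor lowers the power by the deficit \<open>n - a\<close> until 0 is reached, so
  nilpotency can be read off.\<close>

lemma odot_pow_lukasiewicz:
  assumes "a \<le> n"
  shows "odot_pow (lukasiewicz n) a k = n - k * (n - a)"
  using assms by (induction k) (auto simp: odot_pow_def odot_monoid_def nat_pow_def)

lemma reticulation_lukasiewicz:
  assumes "n > 0"
  shows "reticulation (lukasiewicz n) (chain 1) (\<lambda>a. if a = n then 1 else 0)"
    (is "reticulation ?A ?L ?lam")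
proof -
  interpret A: residuated_lattice ?A by (rule residuated_lattice_lukasiewicz)
  interpret L: bounded_distributive_lattice ?L by (rule chain.bounded_distributive_lattice)
  show ?thesis
  proof unfold_locales
    show "?lam ` carrier ?A = carrier ?L"
    proof -
      have "?lam ` {..n} = {?lam 0, ?lam n}"
        using assms by auto
      then show ?thesis
        using assms by (auto simp: le_Suc_eq)
    qed
  next
    fix a b
    assume "a \<in> carrier ?A" "b \<in> carrier ?A"
    then have ab: "a \<le> n" "b \<le> n" by simp_all
    show "?lam (a \<odot>\<^bsub>?A\<^esub> b) = ?lam a \<sqinter>\<^bsub>?L\<^esub> ?lam b"
      \<comment> \<open>With both factors at most \<open>n\<close>, \<open>a + b - n = n\<close>
        forces \<open>a = b = n\<close>.\<close>
      using ab assms by auto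
    show "?lam (a \<squnion>\<^bsub>?A\<^esub> b) = ?lam a \<squnion>\<^bsub>?L\<^esub> ?lam b"
      using ab by (auto simp: max_def)
    show "?lam a \<sqsubseteq>\<^bsub>?L\<^esub> ?lam b \<longleftrightarrow> (\<exists>k\<ge>1. odot_pow ?A a k \<sqsubseteq>\<^bsub>?A\<^esub> b)"
    proof (cases "a = n")
      case True
      then show ?thesis
        \<comment> \<open>All powers of the top are \<open>n\<close>, so both sides reduce to
          \<open>b = n\<close>.\<close>
        using ab by (auto simp: odot_pow_lukasiewicz)
    next
      case False
      \<comment> \<open>The deficit is at least 1, so \<open>n\<close> factors exhaust
        \<open>n\<close>; \<open>n > 0\<close> makes this an admissible exponent.\<close>
      then have "odot_pow ?A a n = 0"
        using ab by (simp add: odot_pow_lukasiewicz)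
      then have "\<exists>k\<ge>1. odot_pow ?A a k \<le> b"
        using assms by (intro exI[of _ n]) simp
      then show ?thesis
        using False by simp
    qed
  qed (use assms in auto)
qed

theorem mainTheorem7:
  shows "\<exists>(A :: nat residuated) (L :: nat gorder) (lam :: nat \<Rightarrow> nat).
    residuated_lattice A
    \<and> \<not> (\<forall>a\<in>carrier A. neg A a \<squnion>\<^bsub>A\<^esub> neg A (neg A a) = \<top>\<^bsub>A\<^esub>)
    \<and> reticulation A L lam
    \<and> pseudocomplemented L
    \<and> (\<forall>l\<in>carrier L. pcompl L l \<squnion>\<^bsub>L\<^esub> pcompl L (pcompl L l) = \<top>\<^bsub>L\<^esub>)"
proof (intro exI conjI)
  let ?A = "lukasiewicz 2"
  show "residuated_lattice ?A"
    by (rule residuated_lattice_lukasiewicz)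
  show "\<not> (\<forall>a\<in>carrier ?A. neg ?A a \<squnion>\<^bsub>?A\<^esub> neg ?A (neg ?A a) = \<top>\<^bsub>?A\<^esub>)"
    \<comment> \<open>The middle element 1 is its own negation, so the join is 1 rather than the top
      2.\<close>
    by (auto simp: neg_lukasiewicz intro!: bexI[of _ 1])
  show "reticulation ?A (chain 1) (\<lambda>a. if a = 2 then 1 else 0)"
    by (rule reticulation_lukasiewicz) simp
  show "pseudocomplemented (chain 1)"
    by (rule chain.pseudocomplemented)
  show "\<forall>l\<in>carrier (chain 1). pcompl (chain 1) l \<squnion>\<^bsub>chain 1\<^esub> pcompl (chain 1) (pcompl (chain 1) l)
      = \<top>\<^bsub>chain 1\<^esub>"
    by (intro ballI chain.stone_identity)
qed

end
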